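(* Let $K\subset L$ be a field extension. Let $A$ and $B$ be two $n$-dimensional $K$-subspaces of $L$ with $1\notin B$ and $n>1$. Assume further that one of the following conditions holds: (1) $B\cap M=\{0\}$ for every finite-dimensional intermediate field $K\subset M\subsetneq L$, and either $n\leq 5$ or every algebraic element of $L$ is separable over $K$; (2) $n=p(K,L)$ and $A$ is not a linear translate of any nontrivial intermediate field $K\subset M\subsetneq L$; (3) $A$ is a Sidon subspace. Then $A$ is matched to $B$.
   Context: For $n$-dimensional $K$-subspaces $A,B$ of $L$, an ordered basis $\{a_1,\ldots,a_n\}$ of $A$ is matched to an ordered basis $\{b_1,\ldots,b_n\}$ of $B$ if $a_i^{-1}A\cap B\subset\langle b_1,\ldots,b_{i-1},b_{i+1},\ldots,b_n\rangle$ for each $1\le i\le n$ (angle brackets denote $K$-span). $A$ is matched to $B$ if every ordered basis of $A$ can be matched to some ordered basis of $B$. $p(K,L)$ denotes the smallest degree $[M:K]$ of an intermediate field $K\subsetneq M\subset L$ ($p(K,L)=\infty$ if there is none of finite degree, e.g. purely transcendental). A linear translate of an intermediate field $M$ is a $K$-subspace of the form $lM$ with $l\in L^*$. A $K$-subspace $A$ of $L$ is a Sidon subspace if $\dim_K(A\cap xA)\le 1$ for all $x\in L\setminus K$. *)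

theory Defs
  imports "HOL-Algebra.Finite_Extensions" "HOL-Library.Extended_Nat"
begin

(* Setting: L is the carrier of a field R (HOL-Algebra), K a subfield of R.
   K-subspaces are 'subalgebra K V R', dimensions are the library's 'dimension'/'dim'
   (HOL-Algebra.Embedded_Algebras), ordered bases are lists. *)

definition (in ring) ordered_basis :: "'a set \<Rightarrow> 'a set \<Rightarrow> 'a list \<Rightarrow> bool"
  where "ordered_basis K V us \<longleftrightarrow> independent K us \<and> Span K us = V"

definition (in ring) bases_matched ::
    "'a set \<Rightarrow> 'a set \<Rightarrow> 'a set \<Rightarrow> 'a list \<Rightarrow> 'a list \<Rightarrow> bool"
  where "bases_matched K A B as bs \<longleftrightarrow>
    (\<forall>i < length as. ((\<lambda>a. inv (as ! i) \<otimes> a) ` A) \<inter> B \<subseteq> Span K (take i bs @ drop (Suc i) bs))"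

definition (in ring) matched :: "'a set \<Rightarrow> 'a set \<Rightarrow> 'a set \<Rightarrow> bool"
  where "matched K A B \<longleftrightarrow>
    (\<forall>as. ordered_basis K A as \<longrightarrow> (\<exists>bs. ordered_basis K B bs \<and> bases_matched K A B as bs))"

definition (in ring) min_degree :: "'a set \<Rightarrow> enat"
  where "min_degree K =
    (INF M \<in> {M. subfield M R \<and> K \<subset> M}. if finite_dimension K M then enat (dim K M) else \<infinity>)"

definition (in ring) sidon :: "'a set \<Rightarrow> 'a set \<Rightarrow> bool"
  where "sidon K A \<longleftrightarrow>
    (\<forall>x \<in> carrier R - K. \<exists>m \<le> 1. dimension m K (A \<inter> (\<lambda>a. x \<otimes> a) ` A))"

text \<open>Formal derivative of a polynomial (coefficient list, leading coefficient first).\<close>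
definition (in ring) formal_deriv :: "'a list \<Rightarrow> 'a list"
  where "formal_deriv p =
    normalize (map (\<lambda>i. [(length p - 1 - i)] \<cdot> (p ! i)) [0..<length p - 1])"

definition (in ring) separable :: "'a set \<Rightarrow> 'a \<Rightarrow> bool"
  where "separable K x \<longleftrightarrow> algebraic K x \<and>
    (\<forall>d \<in> carrier (K[X]). d divides\<^bsub>K[X]\<^esub> Irr K x \<and> d divides\<^bsub>K[X]\<^esub> formal_deriv (Irr K x)
        \<longrightarrow> degree d = 0)"

end

theory Submission
  imports Defs
begin

text \<open>By a linear version of Rado's theorem, a basis \<open>a\<^sub>i\<close> of \<open>A\<close> is matched to some basis of \<open>B\<close> as soon
  as the intersection \<open>W\<close> of \<open>B\<close> with the spaces \<open>a\<^sub>j\<^sup>-\<^sup>1 A\<close>, \<open>j \<in> J\<close>, has dimension at most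
  \<open>n - |J|\<close> for every \<open>J\<close>. If this fails for \<open>J\<close>, let \<open>S\<close> be the span of the \<open>a\<^sub>j\<close>, \<open>j \<in> J\<close>, and
  \<open>U = K + W\<close>. Since \<open>1 \<notin> B\<close>, we have \<open>S U \<subseteq> A\<close> and \<open>dim S + dim U \<ge> n + 2\<close>. Iterating Dyson's
  e-transform on \<open>(S, U)\<close> yields a nonzero subspace of \<open>A\<close> whose stabilizer is a finite-dimensional
  field \<open>M\<close> that contains an element of \<open>B\<close> outside \<open>K\<close>. Here \<open>M \<noteq> L\<close>, since otherwise \<open>A = B = L\<close>.
  Each of the three conditions excludes such an \<open>M\<close>.\<close>

locale field_extension = field R for R (structure) +
  fixes K :: "'a set"
  assumes K: "subfield K R"
begin

section \<open>Subspaces and their dimensions\<close>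

declare Span.simps [simp del]

text \<open>\<open>dim\<close> is a definite description, informative only when some dimension
  exists; this is why finiteness is tracked in every dimension count below.\<close>

lemma fd_dimension: "finite_dimension K E \<Longrightarrow> dimension (dim K E) K E"
  using finite_dimensionE[OF K] by (simp add: over_def)

lemma dim_eqI: "dimension n K E \<Longrightarrow> dim K E = n"
  using dimI[OF K] by (simp add: over_def)

lemma fd_subalgebra: "finite_dimension K E \<Longrightarrow> subalgebra K E R"
  by (rule finite_dimension_imp_subalgebra[OF K])

lemma K_carrier: "K \<subseteq> carrier R"
  using subfieldE(3)[OF K] .

text \<open>Closure under negatives need not be assumed: it is scaling by
  \<open>\<ominus> \<one>\<close>, an element of \<open>K\<close>.\<close>

lemma subalgebraI':
  assumes "V \<subseteq> carrier R" "\<zero> \<in> V" "\<And>u v. u \<in> V \<Longrightarrow> v \<in> V \<Longrightarrow> u \<oplus> v \<in> V"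
    and "\<And>k v. k \<in> K \<Longrightarrow> v \<in> V \<Longrightarrow> k \<otimes> v \<in> V"
  shows "subalgebra K V R"
proof -
  have inv: "\<ominus> v \<in> V" if "v \<in> V" for v
  proof -
    have "(\<ominus> \<one>) \<otimes> v \<in> V"
      using assms(4)[OF _ that] subringE(3,5)[OF subfieldE(1)[OF K]] by blast
    thus ?thesis using that assms(1) by (simp add: l_minus subset_iff)
  qed
  have "subgroup V (add_monoid R)"
    using assms inv by (intro add.subgroupI) (auto simp: a_inv_def)
  thus ?thesis
    by (intro subalgebra.intro) (auto simp: subalgebra_axioms_def assms(4))
qed

lemma subalgebraD:
  assumes "subalgebra K V R"
  shows "V \<subseteq> carrier R" "\<zero> \<in> V" "\<And>u v. u \<in> V \<Longrightarrow> v \<in> V \<Longrightarrow> u \<oplus> v \<in> V"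
    and "\<And>k v. k \<in> K \<Longrightarrow> v \<in> V \<Longrightarrow> k \<otimes> v \<in> V"
    and "\<And>v. v \<in> V \<Longrightarrow> \<ominus> v \<in> V"
proof -
  interpret V: subalgebra K V R by fact
  show "V \<subseteq> carrier R" "\<zero> \<in> V" "\<And>u v. u \<in> V \<Longrightarrow> v \<in> V \<Longrightarrow> u \<oplus> v \<in> V"
    and "\<And>k v. k \<in> K \<Longrightarrow> v \<in> V \<Longrightarrow> k \<otimes> v \<in> V" and "\<And>v. v \<in> V \<Longrightarrow> \<ominus> v \<in> V"
    using V.subset V.one_closed V.m_closed V.smult_closed V.m_inv_closed by (auto simp: a_inv_def)
qed

lemma fd_subspace:
  assumes "finite_dimension K E" "subalgebra K V R" "V \<subseteq> E"
  shows "finite_dimension K V"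
  using subalbegra_incl_imp_finite_dimension[OF K assms] .

lemma dim_mono:
  assumes "finite_dimension K E" "subalgebra K V R" "V \<subseteq> E"
  shows "dim K V \<le> dim K E"
proof -
  obtain Vs where Vs: "independent K Vs" "length Vs = dim K V" "Span K Vs = V"
    using exists_base[OF K fd_dimension[OF fd_subspace[OF assms]]] by blast
  have "set Vs \<subseteq> V" using Span_base_incl[OF K independent_in_carrier[OF Vs(1)]] Vs by simp
  thus ?thesis
    using independent_length_le_dimension[OF K fd_dimension[OF assms(1)] Vs(1)] Vs assms(3) by auto
qed

lemma subspace_eqI:
  assumes "finite_dimension K E" "subalgebra K V R" "V \<subseteq> E" "dim K E \<le> dim K V"
  shows "V = E"
proof -
  obtain Vs where Vs: "independent K Vs" "length Vs = dim K V" "Span K Vs = V"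
    using exists_base[OF K fd_dimension[OF fd_subspace[OF assms(1-3)]]] by blast
  have "set Vs \<subseteq> V" using Span_base_incl[OF K independent_in_carrier[OF Vs(1)]] Vs by simp
  thus ?thesis
    using independent_length_eq_dimension[OF K fd_dimension[OF assms(1)] Vs(1)] Vs assms(3,4)
      dim_mono[OF assms(1-3)] by auto
qed

lemma dim_strict_mono:
  assumes "finite_dimension K E" "subalgebra K V R" "V \<subset> E"
  shows "dim K V < dim K E"
  using subspace_eqI[OF assms(1,2)] assms(3) by (cases "dim K E \<le> dim K V") auto

lemma dim_zero_space: "dim K {\<zero>} = 0"
  by (rule dim_eqI) simp

lemma dim_eq_0D: "finite_dimension K E \<Longrightarrow> dim K E = 0 \<Longrightarrow> E = {\<zero>}"
  using fd_dimension dimension_zero[OF K] by metis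

lemma fd_K: "finite_dimension K K" and dim_K: "dim K K = 1"
  using finite_dimensionI dimension_one[OF K] dim_eqI by blast+

lemma fd_Int:
  assumes "finite_dimension K E" "subalgebra K F R"
  shows "finite_dimension K (E \<inter> F)"
  using fd_subspace[OF assms(1) subalgebra_inter[OF fd_subalgebra[OF assms(1)] assms(2)]] by simp

lemma fd_sum:
  assumes "finite_dimension K E" "finite_dimension K F"
  shows "finite_dimension K (E <+>\<^bsub>R\<^esub> F)"
  using sum_space_dim(1)[OF K assms] .

lemma dim_sum:
  assumes "finite_dimension K E" "finite_dimension K F"
  shows "dim K (E <+>\<^bsub>R\<^esub> F) + dim K (E \<inter> F) = dim K E + dim K F"
proof -
  \<comment> \<open>The library formula subtracts this dimension in the naturals; the bound excludes
    truncation.\<close>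
  have "dim K (E \<inter> F) \<le> dim K E"
    using dim_mono[OF assms(1)] fd_subalgebra fd_Int[OF assms(1)] assms(2) by blast
  thus ?thesis using sum_space_dim(2)[OF K assms] by (simp add: over_def)
qed

lemma sum_subset:
  assumes "subalgebra K V R" "E \<subseteq> V" "F \<subseteq> V"
  shows "E <+>\<^bsub>R\<^esub> F \<subseteq> V"
  using assms subalgebraD(3)[OF assms(1)] by (auto simp: set_add_def' subset_iff)

section \<open>Multiplication of subspaces by a field element\<close>

lemma subalgebra_colon:
  assumes "subalgebra K V R" "e \<in> carrier R"
  shows "subalgebra K {u \<in> carrier R. e \<otimes> u \<in> V} R"
proof (rule subalgebraI')
  fix k v assume *: "k \<in> K" "v \<in> {u \<in> carrier R. e \<otimes> u \<in> V}"
  hence "k \<otimes> (e \<otimes> v) \<in> V" using subalgebraD(4)[OF assms(1)] by blast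
  moreover have "k \<in> carrier R" using * K_carrier by blast
  ultimately show "k \<otimes> v \<in> {u \<in> carrier R. e \<otimes> u \<in> V}"
    using * assms(2) by (simp add: m_lcomm)
qed (use assms subalgebraD(2,3)[OF assms(1)] in \<open>auto simp: r_distr\<close>)

lemma inv_mult_cancel: "x \<in> carrier R - {\<zero>} \<Longrightarrow> y \<in> carrier R \<Longrightarrow> inv x \<otimes> (x \<otimes> y) = y"
  and mult_inv_cancel: "x \<in> carrier R - {\<zero>} \<Longrightarrow> y \<in> carrier R \<Longrightarrow> x \<otimes> (inv x \<otimes> y) = y"
  and inv_nonzero: "x \<in> carrier R - {\<zero>} \<Longrightarrow> inv x \<in> carrier R - {\<zero>}"
  using subfield_m_inv[OF carrier_is_subfield] by (auto simp: m_assoc[symmetric])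

text \<open>Multiplication by a nonzero element is bijective, so its image is the preimage under
  multiplication by the inverse, and \<open>subalgebra_colon\<close> applies to it.\<close>

lemma scale_eq_colon:
  assumes "x \<in> carrier R - {\<zero>}" "V \<subseteq> carrier R"
  shows "(\<lambda>a. x \<otimes> a) ` V = {u \<in> carrier R. inv x \<otimes> u \<in> V}"
  using assms inv_mult_cancel[OF assms(1)] mult_inv_cancel[OF assms(1)] inv_nonzero[OF assms(1)]
  by (auto simp: image_iff subset_iff) metis

lemma scale_subalgebra:
  assumes "x \<in> carrier R - {\<zero>}" "subalgebra K V R"
  shows "subalgebra K ((\<lambda>a. x \<otimes> a) ` V) R"
  using scale_eq_colon[OF assms(1) subalgebraD(1)[OF assms(2)]]
    subalgebra_colon[OF assms(2)] inv_nonzero[OF assms(1)] by simp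

text \<open>The two claims are proved together: the inclusion for the tail turns a dependence of
  \<open>x \<otimes> u\<close> on the scaled tail into a dependence of \<open>u\<close> on the tail,
  by cancelling \<open>x\<close>.\<close>

lemma independent_scale:
  assumes x: "x \<in> carrier R - {\<zero>}" and Us: "independent K Us"
  shows "independent K (map (\<lambda>a. x \<otimes> a) Us) \<and>
    Span K (map (\<lambda>a. x \<otimes> a) Us) \<subseteq> (\<lambda>a. x \<otimes> a) ` Span K Us"
  using Us
proof (induction Us rule: list.induct)
  case Nil
  then show ?case using x by (simp add: Span.simps)
next
  case (Cons u Us)
  note u = independent_backwards[OF Cons.prems]
  have Us: "set (u # Us) \<subseteq> carrier R" using independent_in_carrier[OF Cons.prems] .
  have sub: "subalgebra K ((\<lambda>a. x \<otimes> a) ` Span K (u # Us)) R"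
    using scale_subalgebra[OF x Span_is_subalgebra[OF K Us]] .
  have "Span K (map (\<lambda>a. x \<otimes> a) (u # Us)) \<subseteq> (\<lambda>a. x \<otimes> a) ` Span K (u # Us)"
    using Span_base_incl[OF K Us] by (intro subalgebra_Span_incl[OF K sub]) auto
  moreover have "x \<otimes> u \<notin> Span K (map (\<lambda>a. x \<otimes> a) Us)"
  proof
    assume "x \<otimes> u \<in> Span K (map (\<lambda>a. x \<otimes> a) Us)"
    then obtain v where v: "v \<in> Span K Us" "x \<otimes> u = x \<otimes> v"
      using Cons.IH u(2) by blast
    have "v \<in> carrier R" using v(1) Span_in_carrier[OF K_carrier, of Us] Us by auto
    hence "u = v" using v(2) u(3) x m_lcancel by auto
    thus False using v(1) u(1) by simp
  qed
  ultimately show ?case using Cons.IH u(2,3) x by (auto intro: li_Cons)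
qed

lemma fd_scale:
  assumes "x \<in> carrier R - {\<zero>}" "finite_dimension K E"
  shows "finite_dimension K ((\<lambda>a. x \<otimes> a) ` E)"
    and "dim K ((\<lambda>a. x \<otimes> a) ` E) = dim K E"
proof -
  have *: "finite_dimension K ((\<lambda>a. y \<otimes> a) ` F) \<and> dim K F = dim K ((\<lambda>a. y \<otimes> a) ` F)"
    if y: "y \<in> carrier R - {\<zero>}" and F: "finite_dimension K F" for y F
  proof -
    obtain Vs where Vs: "independent K Vs" "length Vs = dim K F" "Span K Vs = F"
      using exists_base[OF K fd_dimension[OF F]] by blast
    let ?W = "map (\<lambda>a. y \<otimes> a) Vs"
    have ind: "independent K ?W" "Span K ?W \<subseteq> (\<lambda>a. y \<otimes> a) ` F"
      using independent_scale[OF y Vs(1)] Vs(3) by auto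
    have carr: "set ?W \<subseteq> carrier R" using independent_in_carrier[OF ind(1)] .
    \<comment> \<open>For the reverse inclusion it suffices to test basis vectors, since the vectors
      that \<open>y\<close> multiplies into the span form a subspace.\<close>
    have FW: "v \<in> {u \<in> carrier R. y \<otimes> u \<in> Span K ?W}" if "v \<in> F" for v
    proof -
      have "subalgebra K {u \<in> carrier R. y \<otimes> u \<in> Span K ?W} R"
        using subalgebra_colon[OF Span_is_subalgebra[OF K carr]] y by blast
      moreover have "set Vs \<subseteq> {u \<in> carrier R. y \<otimes> u \<in> Span K ?W}"
        using Span_base_incl[OF K carr] independent_in_carrier[OF Vs(1)] by auto
      ultimately show ?thesis
        using subalgebra_Span_incl[OF K, of _ Vs] Vs(3) that by blast
    qed
    have "Span K ?W = (\<lambda>a. y \<otimes> a) ` F" using ind(2) FW by blast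
    thus ?thesis
      using dimensionI[OF K ind(1)] dim_eqI finite_dimensionI Vs(2) by (metis length_map)
  qed
  show "finite_dimension K ((\<lambda>a. x \<otimes> a) ` E)"
    and "dim K ((\<lambda>a. x \<otimes> a) ` E) = dim K E"
    using *[OF assms] by auto
qed

lemma line_extension_fd:
  assumes "finite_dimension K V" "x \<in> carrier R" "x \<notin> V"
  shows "finite_dimension K (line_extension K x V)" "dim K (line_extension K x V) = Suc (dim K V)"
    "x \<in> line_extension K x V" "V \<subseteq> line_extension K x V"
proof -
  have d: "dimension (Suc (dim K V)) K (line_extension K x V)"
    using Suc_dim[OF assms(2,3) fd_dimension[OF assms(1)]] .
  show "finite_dimension K (line_extension K x V)" "dim K (line_extension K x V) = Suc (dim K V)"
    using finite_dimensionI[OF d] dim_eqI[OF d] by auto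
  note V = subalgebraD[OF fd_subalgebra[OF assms(1)]]
  have "\<one> \<in> K" "\<zero> \<in> K" using subringE(2,3)[OF subfieldE(1)[OF K]] by auto
  thus "x \<in> line_extension K x V" "V \<subseteq> line_extension K x V"
    using V(1,2) assms(2) by (force simp: line_extension_mem_iff)+
qed

lemma line_extension_subset:
  assumes "subalgebra K B R" "V \<subseteq> B" "x \<in> B"
  shows "line_extension K x V \<subseteq> B"
  using assms subalgebraD(3,4)[OF assms(1)] by (auto simp: line_extension_mem_iff subset_iff)

text \<open>The second extension contains \<open>y\<close>, so the intersection is a proper subspace
  of it; having dimension at most \<open>dim K V\<close>, it cannot exceed \<open>V\<close>.\<close>

lemma line_extension_Int:
  assumes V: "finite_dimension K V" and x: "x \<in> carrier R" "x \<notin> V"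
    and y: "y \<in> carrier R" "y \<notin> line_extension K x V"
  shows "line_extension K x V \<inter> line_extension K y V = V"
proof -
  let ?E = "line_extension K x V" and ?F = "line_extension K y V"
  note E = line_extension_fd[OF V x]
  have yV: "y \<notin> V" using E(4) y(2) by blast
  note F = line_extension_fd[OF V y(1) yV]
  have I: "finite_dimension K (?E \<inter> ?F)" using fd_Int[OF E(1) fd_subalgebra[OF F(1)]] .
  have "dim K (?E \<inter> ?F) < dim K ?F"
    using dim_strict_mono[OF F(1) fd_subalgebra[OF I]] F(3) y(2) by blast
  hence "V = ?E \<inter> ?F"
    using subspace_eqI[OF I fd_subalgebra[OF V]] E(4) F(2,4) by simp
  thus ?thesis by simp
qed

section \<open>A linear Rado theorem in dual form\<close>

lemma subalgebra_INT:
  assumes "finite J" "subalgebra K B R" "\<And>i. i \<in> J \<Longrightarrow> subalgebra K (V i) R"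
  shows "subalgebra K (B \<inter> (\<Inter>i\<in>J. V i)) R"
  using assms(1,3)
proof (induction J rule: finite_induct)
  case empty
  then show ?case using assms(2) by simp
next
  case (insert j J)
  have "B \<inter> (\<Inter>i\<in>insert j J. V i) = (B \<inter> (\<Inter>i\<in>J. V i)) \<inter> V j" by auto
  then show ?case using insert subalgebra_inter by simp
qed

text \<open>This is Rado's condition for the annihilators of the \<open>V i\<close> in the dual of
  \<open>B\<close>, expressed by intersections so that no dual space is needed. The factor
  \<open>B\<close> gives the empty family the intersection \<open>B\<close>.\<close>

definition hall :: "'a set \<Rightarrow> 'i set \<Rightarrow> ('i \<Rightarrow> 'a set) \<Rightarrow> bool"
  where "hall B I V \<longleftrightarrow> (\<forall>i\<in>I. subalgebra K (V i) R \<and> V i \<subseteq> B) \<and>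
    (\<forall>J\<subseteq>I. dim K (B \<inter> (\<Inter>i\<in>J. V i)) + card J \<le> dim K B)"

text \<open>Only the member at \<open>i\<close> changes, so a violating index set must contain
  \<open>i\<close>. The set \<open>J\<close> obtained is the violating one without \<open>i\<close>,
  whence the \<open>Suc\<close>.\<close>

lemma hall_violation:
  assumes fin: "finite I" and h: "hall B I V" and i: "i \<in> I" and E: "subalgebra K E R" "E \<subseteq> B"
    and n: "\<not> hall B I (V(i := E))"
  obtains J where "J \<subseteq> I" "i \<notin> J" "dim K B < dim K (E \<inter> (\<Inter>j\<in>J. V j)) + Suc (card J)"
proof -
  obtain J where J: "J \<subseteq> I"
    "\<not> dim K (B \<inter> (\<Inter>j\<in>J. (V(i := E)) j)) + card J \<le> dim K B"
    using n h E unfolding hall_def by (metis (no_types, lifting) fun_upd_apply)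
  have "i \<in> J"
  proof (rule ccontr)
    assume "i \<notin> J"
    hence "(\<Inter>j\<in>J. (V(i := E)) j) = (\<Inter>j\<in>J. V j)" by auto
    thus False using J h unfolding hall_def by auto
  qed
  have "finite J" using J(1) fin finite_subset by blast
  have "B \<inter> (\<Inter>j\<in>J. (V(i := E)) j) = E \<inter> (\<Inter>j\<in>J - {i}. V j)"
    using \<open>i \<in> J\<close> E(2) by (auto split: if_splits)
  moreover have "card J = Suc (card (J - {i}))"
    using card_Suc_Diff1[OF \<open>finite J\<close> \<open>i \<in> J\<close>] by simp
  ultimately show thesis
    using that[of "J - {i}"] J by force
qed


text \<open>As in Rado's proof, a \<open>V i\<close> of codimension at least 2 can be enlarged: if neither of two
  one-dimensional enlargements that meet in \<open>V i\<close> preserves the Hall condition, then the dimension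
  formula applied to the two violating intersections contradicts the condition for \<open>V\<close>.\<close>

lemma hall_hyperplanes:
  assumes fin: "finite I" and B: "finite_dimension K B" and "hall B I V"
  shows "\<exists>H. hall B I H \<and> (\<forall>i\<in>I. V i \<subseteq> H i \<and> Suc (dim K (H i)) = dim K B)"
  using assms(3)
\<comment> \<open>The measure is the total codimension of the \<open>V i\<close> in
  \<open>B\<close>; each enlargement lowers it.\<close>
proof (induction "\<Sum>i\<in>I. dim K B - dim K (V i)" arbitrary: V rule: less_induct)
  case less
  note h = less.prems
  have V: "subalgebra K (V i) R" "V i \<subseteq> B" if "i \<in> I" for i
    using h that unfolding hall_def by auto
  note fdV = fd_subspace[OF B V]
  have inter: "dim K (B \<inter> (\<Inter>i\<in>J. V i)) + card J \<le> dim K B" if "J \<subseteq> I" for J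
    using h that unfolding hall_def by blast
  \<comment> \<open>The condition for a singleton gives codimension at least 1, so a member that is
    not a hyperplane has codimension at least 2.\<close>
  have le: "Suc (dim K (V i)) \<le> dim K B" if "i \<in> I" for i
    using inter[of "{i}"] V(2)[OF that] that by (simp add: Int_absorb1)
  show ?case
  proof (cases "\<forall>i\<in>I. Suc (dim K (V i)) = dim K B")
    case True
    then show ?thesis using h by blast
  next
    case False
    then obtain i where i: "i \<in> I" "Suc (dim K (V i)) < dim K B"
      using le by (meson le_neq_implies_less)
    note Bsub = fd_subalgebra[OF B]
    have Bc: "B \<subseteq> carrier R" using subalgebraD(1)[OF Bsub] .
    obtain x where x: "x \<in> B" "x \<notin> V i" using i(2) V(2)[OF i(1)] by (metis less_not_refl Suc_lessD subset_antisym subsetI)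
    define E where "E = line_extension K x (V i)"
    note E = line_extension_fd[OF fdV[OF i(1) i(1)] subsetD[OF Bc x(1)] x(2), folded E_def]
    have EB: "E \<subseteq> B" unfolding E_def by (rule line_extension_subset[OF Bsub V(2)[OF i(1)] x(1)])
    \<comment> \<open>Codimension at least 2 keeps \<open>E\<close> a proper subspace of
      \<open>B\<close>, leaving room for a second direction.\<close>
    obtain y where y: "y \<in> B" "y \<notin> E" using i(2) EB E(2) by (metis less_not_refl subset_antisym subsetI)
    have yV: "y \<notin> V i" using E(4) y(2) by blast
    define F where "F = line_extension K y (V i)"
    note F = line_extension_fd[OF fdV[OF i(1) i(1)] subsetD[OF Bc y(1)] yV, folded F_def]
    have FB: "F \<subseteq> B" unfolding F_def by (rule line_extension_subset[OF Bsub V(2)[OF i(1)] y(1)])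
    have EF: "E \<inter> F = V i"
      using line_extension_Int[OF fdV[OF i(1) i(1)] subsetD[OF Bc x(1)] x(2) subsetD[OF Bc y(1)]] y(2)
      unfolding E_def F_def by blast
    have "hall B I (V(i := E)) \<or> hall B I (V(i := F))"
    proof (rule ccontr)
      assume "\<not> ?thesis"
      hence n1: "\<not> hall B I (V(i := E))" and n2: "\<not> hall B I (V(i := F))" by auto
      obtain J where J: "J \<subseteq> I" "i \<notin> J" "dim K B < dim K (E \<inter> (\<Inter>j\<in>J. V j)) + Suc (card J)"
        using hall_violation[OF fin h i(1) fd_subalgebra[OF E(1)] EB n1] .
      obtain L where L: "L \<subseteq> I" "i \<notin> L" "dim K B < dim K (F \<inter> (\<Inter>j\<in>L. V j)) + Suc (card L)"
        using hall_violation[OF fin h i(1) fd_subalgebra[OF F(1)] FB n2] .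
      have fJL: "finite J" "finite L" using J(1) L(1) fin finite_subset by blast+
      let ?P = "E \<inter> (\<Inter>j\<in>J. V j)" and ?Q = "F \<inter> (\<Inter>j\<in>L. V j)"
      have "subalgebra K ?P R" "subalgebra K ?Q R"
        using subalgebra_INT[OF fJL(1) fd_subalgebra[OF E(1)]]
          subalgebra_INT[OF fJL(2) fd_subalgebra[OF F(1)]] V(1) J(1) L(1) by blast+
      hence P: "finite_dimension K ?P" and Q: "finite_dimension K ?Q"
        using fd_subspace[OF E(1)] fd_subspace[OF F(1)] by blast+
      \<comment> \<open>The condition for \<open>V\<close> is used twice: here for
        \<open>insert i (J \<union> L)\<close>, because \<open>E\<close> and \<open>F\<close> meet
        in \<open>V i\<close>, and below for \<open>J \<inter> L\<close>, whose intersection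
        contains the sum of \<open>?P\<close> and \<open>?Q\<close>.\<close>
      have "?P \<inter> ?Q = B \<inter> (\<Inter>j\<in>insert i (J \<union> L). V j)"
        using EF V(2)[OF i(1)] by auto
      hence 1: "dim K (?P \<inter> ?Q) + Suc (card (J \<union> L)) \<le> dim K B"
        using inter[of "insert i (J \<union> L)"] i(1) J(1,2) L(1,2) fJL by simp
      have sub: "subalgebra K (B \<inter> (\<Inter>j\<in>J \<inter> L. V j)) R"
        using subalgebra_INT[OF _ Bsub, of "J \<inter> L" V] V(1) J(1) fJL by blast
      have "?P <+>\<^bsub>R\<^esub> ?Q \<subseteq> B \<inter> (\<Inter>j\<in>J \<inter> L. V j)"
        using EB FB by (intro sum_subset[OF sub]) auto
      moreover have "finite_dimension K (B \<inter> (\<Inter>j\<in>J \<inter> L. V j))"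
        using fd_subspace[OF B sub] by blast
      ultimately have "dim K (?P <+>\<^bsub>R\<^esub> ?Q) \<le> dim K (B \<inter> (\<Inter>j\<in>J \<inter> L. V j))"
        using dim_mono fd_subalgebra[OF fd_sum[OF P Q]] by blast
      hence 2: "dim K (?P <+>\<^bsub>R\<^esub> ?Q) + card (J \<inter> L) \<le> dim K B"
        using inter[of "J \<inter> L"] J(1) by fastforce
      \<comment> \<open>Facts 1 and 2 bound \<open>dim K ?P + dim K ?Q + card J + card L + 1\<close>
        by \<open>2 * dim K B\<close>, while the two violations make the same sum without the 1 at
        least \<open>2 * dim K B\<close>.\<close>
      show False
        using 1 2 J(3) L(3) dim_sum[OF P Q] card_Un_Int[OF fJL] by linarith
    qed
    then obtain Z where Z: "hall B I (V(i := Z))" "V i \<subseteq> Z" "dim K Z = Suc (dim K (V i))"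
      using E(2,4) F(2,4) by blast
    have "(\<Sum>j\<in>I. dim K B - dim K ((V(i := Z)) j)) < (\<Sum>j\<in>I. dim K B - dim K (V j))"
      using i Z(3) by (intro sum_strict_mono_ex1[OF fin]) auto
    from less.hyps[OF this Z(1)] obtain H
      where H: "hall B I H" "\<forall>j\<in>I. (V(i := Z)) j \<subseteq> H j \<and> Suc (dim K (H j)) = dim K B"
      by blast
    have "V j \<subseteq> H j" if "j \<in> I" for j
      using H(2)[rule_format, OF that] Z(2) by (auto split: if_splits)
    then show ?thesis using H by blast
  qed
qed

text \<open>Each further hyperplane lowers the dimension by at most one, because its sum with the
  previous intersection stays in \<open>B\<close>. This is the bound opposite to the one in
  \<open>hall\<close>.\<close>

lemma dim_hyperplane_INT:
  assumes B: "finite_dimension K B" and "finite J"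
    and "\<And>i. i \<in> J \<Longrightarrow> subalgebra K (H i) R \<and> H i \<subseteq> B \<and> Suc (dim K (H i)) = dim K B"
  shows "dim K B \<le> dim K (B \<inter> (\<Inter>i\<in>J. H i)) + card J"
  using assms(2,3)
proof (induction J rule: finite_induct)
  case empty
  then show ?case by simp
next
  case (insert j J)
  let ?P = "B \<inter> (\<Inter>i\<in>J. H i)"
  have P: "finite_dimension K ?P"
    using fd_subspace[OF B subalgebra_INT[OF insert.hyps(1) fd_subalgebra[OF B], of H]]
      insert.prems by blast
  have Hj: "finite_dimension K (H j)" using fd_subspace[OF B] insert.prems by blast
  have "dim K (?P <+>\<^bsub>R\<^esub> H j) \<le> dim K B"
    using dim_mono[OF B fd_subalgebra[OF fd_sum[OF P Hj]]]
      sum_subset[OF fd_subalgebra[OF B], of ?P "H j"] insert.prems by blast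
  moreover have "B \<inter> (\<Inter>i\<in>insert j J. H i) = ?P \<inter> H j" by auto
  moreover have "Suc (dim K (H j)) = dim K B" "dim K B \<le> dim K ?P + card J"
    using insert by auto
  ultimately show ?case
    using dim_sum[OF P Hj] insert.hyps by simp
qed

text \<open>After enlargement to hyperplanes \<open>H i\<close>, all \<open>n\<close> of them meet
  in zero, but any \<open>n - 1\<close> share a nonzero vector. These vectors form the basis dual to
  the hyperplanes: \<open>H i\<close> is spanned by all of them except the one with index
  \<open>i\<close>.\<close>

lemma hall_basis:
  assumes B: "finite_dimension K B" and n: "dim K B = n" and h: "hall B {..<n} V"
  shows "\<exists>bs. ordered_basis K B bs \<and> (\<forall>i<n. V i \<subseteq> Span K (take i bs @ drop (Suc i) bs))"
proof -
  obtain H where H: "hall B {..<n} H"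
    "\<And>i. i < n \<Longrightarrow> V i \<subseteq> H i" "\<And>i. i < n \<Longrightarrow> Suc (dim K (H i)) = n"
    using hall_hyperplanes[OF _ B h] n by auto
  have Hs: "subalgebra K (H i) R" "H i \<subseteq> B" if "i < n" for i
    using H(1) that unfolding hall_def by auto
  note Bsub = fd_subalgebra[OF B]
  have Bc: "B \<subseteq> carrier R" using subalgebraD(1)[OF Bsub] .
  have full: "B \<inter> (\<Inter>i\<in>{..<n}. H i) = {\<zero>}"
  proof (rule dim_eq_0D)
    show "finite_dimension K (B \<inter> (\<Inter>i\<in>{..<n}. H i))"
      using fd_subspace[OF B subalgebra_INT[OF _ Bsub, of "{..<n}" H]] Hs by auto
    have "dim K (B \<inter> (\<Inter>i\<in>{..<n}. H i)) + card {..<n} \<le> dim K B"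
      using H(1) unfolding hall_def by blast
    thus "dim K (B \<inter> (\<Inter>i\<in>{..<n}. H i)) = 0" using n by simp
  qed
  have "\<exists>b. b \<in> B \<and> (\<forall>j<n. j \<noteq> i \<longrightarrow> b \<in> H j) \<and> b \<notin> H i" if i: "i < n" for i
  proof -
    let ?P = "B \<inter> (\<Inter>j\<in>{..<n} - {i}. H j)"
    have "n \<le> dim K ?P + card ({..<n} - {i})"
      using dim_hyperplane_INT[OF B, of "{..<n} - {i}" H] Hs H(3) n by auto
    hence "dim K ?P \<noteq> 0" using i by simp
    hence "?P \<noteq> {\<zero>}" using dim_zero_space by metis
    moreover have "\<zero> \<in> ?P" using subalgebraD(2)[OF Bsub] subalgebraD(2)[OF Hs(1)] by auto
    ultimately obtain b where b: "b \<in> ?P" "b \<noteq> \<zero>" by blast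
    hence "b \<notin> H i" using full by auto
    thus ?thesis using b by auto
  qed
  then obtain b where b: "\<And>i. i < n \<Longrightarrow> b i \<in> B" "\<And>i. i < n \<Longrightarrow> b i \<notin> H i"
      "\<And>i j. i < n \<Longrightarrow> j < n \<Longrightarrow> j \<noteq> i \<Longrightarrow> b i \<in> H j"
    by metis
  have Span_H: "Span K (map b js) \<subseteq> H j" if "set js \<subseteq> {..<n} - {j}" "j < n" for j js
    using b(3) that by (intro subalgebra_Span_incl[OF K Hs(1)[OF that(2)]]) auto
  \<comment> \<open>General index lists are allowed because both the full list and the list without
    \<open>i\<close> occur below. A vector \<open>b j\<close> is independent of the others since
    they all lie in \<open>H j\<close>.\<close>
  have ind: "independent K (map b js)" if "distinct js" "set js \<subseteq> {..<n}" for js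
    using that
  proof (induction js rule: list.induct)
    case Nil
    then show ?case by simp
  next
    case (Cons j js)
    hence "b j \<notin> Span K (map b js)" using Span_H[of js j] b(2)[of j] by auto
    then show ?case using Cons b(1) Bc by (auto intro!: li_Cons)
  qed
  define bs where "bs = map b [0..<n]"
  have ind_bs: "independent K bs" unfolding bs_def by (rule ind) auto
  have "set bs \<subseteq> B" "length bs = dim K B" using b(1) n unfolding bs_def by auto
  hence basis: "ordered_basis K B bs"
    unfolding ordered_basis_def
    using independent_length_eq_dimension[OF K fd_dimension[OF B] ind_bs] ind_bs by blast
  have "V i \<subseteq> Span K (take i bs @ drop (Suc i) bs)" if i: "i < n" for i
  proof -
    let ?js = "[0..<i] @ [Suc i..<n]"
    have eq: "take i bs @ drop (Suc i) bs = map b ?js"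
      unfolding bs_def using i by (simp add: take_map drop_map take_upt)
    have ind': "independent K (map b ?js)" using i by (intro ind) auto
    have "set (map b ?js) \<subseteq> H i" using b(3) i by auto
    moreover have "length (map b ?js) = dim K (H i)" using H(3)[OF i] i by simp
    ultimately have "Span K (map b ?js) = H i"
      using independent_length_eq_dimension[OF K fd_dimension[OF fd_subspace[OF B Hs[OF i]]] ind'] i
      by blast
    thus ?thesis using H(2)[OF i] eq by simp
  qed
  thus ?thesis using basis by blast
qed


section \<open>The e-transform for pairs of subspaces\<close>

text \<open>Dyson's e-transform \<open>(S, U) \<mapsto> (S + eU, U \<inter> e\<^sup>-\<^sup>1 S)\<close> preserves the sum of the dimensions and
  does not enlarge the product; it terminates at a pair with \<open>S U \<subseteq> S\<close>.\<close>

lemma dyson_transform: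
  assumes A: "finite_dimension K A"
    and "finite_dimension K S" "S \<noteq> {\<zero>}" "finite_dimension K U" "\<one> \<in> U"
    and "\<And>s u. s \<in> S \<Longrightarrow> u \<in> U \<Longrightarrow> s \<otimes> u \<in> A"
    and "dim K A + 2 \<le> dim K S + dim K U"
  shows "\<exists>S' U'. finite_dimension K S' \<and> S' \<subseteq> A \<and> S' \<noteq> {\<zero>} \<and> subalgebra K U' R \<and> U' \<subseteq> U \<and>
    2 \<le> dim K U' \<and> (\<forall>s\<in>S'. \<forall>u\<in>U'. s \<otimes> u \<in> S')"
  using assms(2-)
proof (induction "dim K U" arbitrary: S U rule: less_induct)
  case less
  note S = less.prems(1) and U = less.prems(3) and one = less.prems(4)
    and prod = less.prems(5) and dims = less.prems(6)
  note Ssub = subalgebraD[OF fd_subalgebra[OF S]]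
  note Usub = subalgebraD[OF fd_subalgebra[OF U]]
  note Asub = subalgebraD[OF fd_subalgebra[OF A]]
  have SA: "S \<subseteq> A" using prod[OF _ one] Ssub(1) by (force simp: subset_iff)
  show ?case
  proof (cases "\<forall>s\<in>S. \<forall>u\<in>U. s \<otimes> u \<in> S")
    case True
    \<comment> \<open>At termination \<open>S\<close> still lies in \<open>A\<close>, so the surplus
      of 2 in the dimension sum must come from \<open>U\<close>.\<close>
    have "dim K S \<le> dim K A" using dim_mono[OF A fd_subalgebra[OF S] SA] .
    hence "2 \<le> dim K U" using dims by simp
    then show ?thesis using True S SA less.prems(2) fd_subalgebra[OF U] by blast
  next
    case False
    \<comment> \<open>The witness \<open>u0\<close> is lost from \<open>U\<close> in the transform
      with this \<open>e\<close>, so the dimension of \<open>U\<close> drops strictly.\<close>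
    then obtain e u0 where e: "e \<in> S" "u0 \<in> U" "e \<otimes> u0 \<notin> S" by blast
    have ec: "e \<in> carrier R - {\<zero>}" using e Ssub(1,2) Usub(1) by auto
    define U' where "U' = U \<inter> {u \<in> carrier R. e \<otimes> u \<in> S}"
    define eU where "eU = (\<lambda>u. e \<otimes> u) ` U"
    have eU: "finite_dimension K eU" "dim K eU = dim K U"
      using fd_scale[OF ec U] unfolding eU_def by auto
    have U': "finite_dimension K U'"
      unfolding U'_def using fd_Int[OF U subalgebra_colon[OF fd_subalgebra[OF S]]] ec by blast
    have "U' \<subset> U" using e unfolding U'_def by blast
    hence less_dim: "dim K U' < dim K U" using dim_strict_mono[OF U fd_subalgebra[OF U']] by blast
    \<comment> \<open>What the sum loses to the overlap of \<open>S\<close> and \<open>eU\<close> is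
      exactly what \<open>U'\<close> retains, so the total dimension is preserved.\<close>
    have "S \<inter> eU = (\<lambda>u. e \<otimes> u) ` U'" unfolding U'_def eU_def using Usub(1) by auto
    hence "dim K (S \<inter> eU) = dim K U'" using fd_scale(2)[OF ec U'] by simp
    hence "dim K A + 2 \<le> dim K (S <+>\<^bsub>R\<^esub> eU) + dim K U'"
      using dim_sum[OF S eU(1)] eU(2) dims by simp
    moreover have "S <+>\<^bsub>R\<^esub> eU \<noteq> {\<zero>}"
    proof -
      have "e \<oplus> \<zero> \<in> S <+>\<^bsub>R\<^esub> eU"
        using e(1) subalgebraD(2)[OF fd_subalgebra[OF eU(1)]] unfolding set_add_def' by blast
      thus ?thesis using ec by auto
    qed
    moreover have "\<one> \<in> U'" using one e(1) ec unfolding U'_def by auto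
    moreover have "s \<otimes> u \<in> A" if su: "s \<in> S <+>\<^bsub>R\<^esub> eU" "u \<in> U'" for s u
    proof -
      obtain t v where tv: "t \<in> S" "v \<in> U" "s = t \<oplus> e \<otimes> v"
        using su(1) unfolding set_add_def' eU_def by auto
      have u: "u \<in> U" "u \<in> carrier R" "e \<otimes> u \<in> S" using su(2) unfolding U'_def by auto
      have c: "t \<in> carrier R" "v \<in> carrier R" using tv Ssub(1) Usub(1) by auto
      \<comment> \<open>Commutativity moves \<open>u\<close> next to \<open>e\<close>; as
        \<open>e \<otimes> u\<close> lies in \<open>S\<close>, both summands are products of an
        element of \<open>S\<close> and one of \<open>U\<close>.\<close>
      have "s \<otimes> u = t \<otimes> u \<oplus> (e \<otimes> u) \<otimes> v"
        using tv(3) u(2) c ec by (simp add: l_distr m_assoc m_comm[of v u])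
      thus ?thesis using Asub(3) prod[OF tv(1) u(1)] prod[OF u(3) tv(2)] by simp
    qed
    ultimately obtain S' V where *: "finite_dimension K S' \<and> S' \<subseteq> A \<and> S' \<noteq> {\<zero>} \<and>
        subalgebra K V R \<and> V \<subseteq> U' \<and> 2 \<le> dim K V \<and> (\<forall>s\<in>S'. \<forall>u\<in>V. s \<otimes> u \<in> S')"
      using less.hyps[OF less_dim fd_sum[OF S eU(1)] _ U'] by blast
    moreover have "U' \<subseteq> U" unfolding U'_def by blast
    ultimately show ?thesis by blast
  qed
qed

section \<open>Stabilizers of finite-dimensional subspaces\<close>

definition stabilizer :: "'a set \<Rightarrow> 'a set"
  where "stabilizer V = {x \<in> carrier R. \<forall>v\<in>V. x \<otimes> v \<in> V}"

lemma stabilizer_subspace: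
  assumes "subalgebra K V R"
  shows "subalgebra K (stabilizer V) R"
proof -
  note V = subalgebraD[OF assms]
  have "k \<otimes> x \<otimes> v = k \<otimes> (x \<otimes> v)" if "k \<in> K" "x \<in> carrier R" "v \<in> V" for k x v
    using that K_carrier V(1) by (intro m_assoc) auto
  moreover have "(x \<oplus> y) \<otimes> v = x \<otimes> v \<oplus> y \<otimes> v"
    if "x \<in> carrier R" "y \<in> carrier R" "v \<in> V" for x y v
    using that V(1) by (intro l_distr) auto
  ultimately show ?thesis
    using V K_carrier unfolding stabilizer_def by (intro subalgebraI') (auto simp: subset_iff)
qed

text \<open>Multiplication by a nonzero \<open>v\<close> of \<open>V\<close> embeds the stabilizer
  into \<open>V\<close>. Finite dimension of the image is carried back by multiplying with
  \<open>inv v\<close>.\<close>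

lemma stabilizer_scale:
  assumes V: "finite_dimension K V" and v: "v \<in> V" "v \<noteq> \<zero>"
  shows "(\<lambda>m. v \<otimes> m) ` stabilizer V \<subseteq> V" "finite_dimension K (stabilizer V)"
    "dim K ((\<lambda>m. v \<otimes> m) ` stabilizer V) = dim K (stabilizer V)"
    "dim K (stabilizer V) \<le> dim K V"
proof -
  let ?M = "stabilizer V"
  note Vc = subalgebraD(1)[OF fd_subalgebra[OF V]]
  have vc: "v \<in> carrier R - {\<zero>}" using v Vc by auto
  note sub = stabilizer_subspace[OF fd_subalgebra[OF V]]
  note vsub = scale_subalgebra[OF vc sub]
  show vM: "(\<lambda>m. v \<otimes> m) ` ?M \<subseteq> V"
    using v(1) vc by (auto simp: stabilizer_def m_comm)
  note fd = fd_subspace[OF V vsub vM]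
  have "(\<lambda>m. inv v \<otimes> m) ` ((\<lambda>m. v \<otimes> m) ` ?M) = ?M"
    using inv_mult_cancel[OF vc] by (force simp: stabilizer_def image_image)
  thus "finite_dimension K ?M" using fd_scale(1)[OF inv_nonzero[OF vc] fd] by simp
  thus "dim K ((\<lambda>m. v \<otimes> m) ` ?M) = dim K ?M" using fd_scale(2)[OF vc] by simp
  thus "dim K ?M \<le> dim K V" using dim_mono[OF V vsub vM] by simp
qed

text \<open>An injective linear map of a finite-dimensional space into itself is onto. This is what
  puts inverses into the stabilizer and makes it a field.\<close>

lemma scale_stable_eq:
  assumes V: "finite_dimension K V" and x: "x \<in> stabilizer V" "x \<noteq> \<zero>"
  shows "(\<lambda>v. x \<otimes> v) ` V = V"
proof -
  have xc: "x \<in> carrier R - {\<zero>}" using x by (auto simp: stabilizer_def)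
  show ?thesis
    using subspace_eqI[OF V scale_subalgebra[OF xc fd_subalgebra[OF V]]] fd_scale(2)[OF xc V] x
    by (auto simp: stabilizer_def)
qed

lemma stabilizer_subfield:
  assumes V: "finite_dimension K V"
  shows "subfield (stabilizer V) R"
proof (rule subfieldI')
  note Vs = subalgebraD[OF fd_subalgebra[OF V]]
  note M = subalgebraD[OF stabilizer_subspace[OF fd_subalgebra[OF V]]]
  show "subring (stabilizer V) R"
  proof (rule subringI)
    show "\<one> \<in> stabilizer V" using Vs(1) by (auto simp: stabilizer_def)
    show "x \<otimes> y \<in> stabilizer V" if "x \<in> stabilizer V" "y \<in> stabilizer V" for x y
    proof -
      have "x \<otimes> y \<otimes> v = x \<otimes> (y \<otimes> v)" if "v \<in> V" for v
        using that \<open>x \<in> _\<close> \<open>y \<in> _\<close> Vs(1) by (intro m_assoc) (auto simp: stabilizer_def)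
      thus ?thesis using that by (auto simp: stabilizer_def)
    qed
  qed (use M in auto)
  fix x assume x: "x \<in> stabilizer V - {\<zero>}"
  hence xc: "x \<in> carrier R - {\<zero>}" by (auto simp: stabilizer_def)
  have "inv x \<otimes> v \<in> V" if v: "v \<in> V" for v
  proof -
    obtain w where w: "w \<in> V" "v = x \<otimes> w" using scale_stable_eq[OF V] x v by blast
    thus ?thesis using inv_mult_cancel[OF xc] Vs(1) by auto
  qed
  thus "inv x \<in> stabilizer V" using inv_nonzero[OF xc] by (auto simp: stabilizer_def)
qed

lemma K_subset_stabilizer: "subalgebra K V R \<Longrightarrow> K \<subseteq> stabilizer V"
  using subalgebraD(4) K_carrier by (auto simp: stabilizer_def)

section \<open>From an unmatched basis to a stable subspace\<close>

lemma K_Int_trivial: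
  assumes "subalgebra K B R" "\<one> \<notin> B"
  shows "K \<inter> B = {\<zero>}"
proof -
  have "k = \<zero>" if k: "k \<in> K" "k \<in> B" for k
  proof (rule ccontr)
    assume "k \<noteq> \<zero>"
    hence "inv k \<in> K" "inv k \<otimes> k = \<one>" using subfield_m_inv[OF K, of k] k by auto
    thus False using subalgebraD(4)[OF assms(1) _ k(2), of "inv k"] assms(2) by simp
  qed
  thus ?thesis
    using subalgebraD(2)[OF assms(1)] subringE(2)[OF subfieldE(1)[OF K]] by blast
qed

lemma independent_nth_nonzero:
  assumes "independent K us" "i < length us"
  shows "us ! i \<in> carrier R - {\<zero>}"
proof -
  have "us = take i us @ us ! i # drop (Suc i) us" using id_take_nth_drop[OF assms(2)] .
  hence "independent K (us ! i # drop (Suc i) us)"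
    using independent_split(1)[OF K] assms(1) by metis
  hence "us ! i \<notin> Span K (drop (Suc i) us)" using independent_backwards(1) by blast
  moreover have "set (drop (Suc i) us) \<subseteq> carrier R"
    using independent_in_carrier[OF assms(1)] set_drop_subset[of "Suc i" us] by (rule subset_trans[rotated])
  ultimately have "us ! i \<noteq> \<zero>" using Span_subgroup_props(2)[OF K, of "drop (Suc i) us"] by auto
  thus ?thesis using independent_in_carrier[OF assms(1)] nth_mem[OF assms(2)] by blast
qed

text \<open>The entries with index in \<open>J\<close>, followed by the remaining ones, rearrange
  \<open>us\<close>; independence survives rearrangement and passes to an initial segment.\<close>

lemma independent_filter:
  assumes "independent K us" "J \<subseteq> {..<length us}"
  shows "independent K (map ((!) us) (filter (\<lambda>i. i \<in> J) [0..<length us]))"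
proof -
  let ?f = "\<lambda>P. map ((!) us) (filter P [0..<length us])"
  have "set (?f (\<lambda>i. i \<in> J) @ ?f (\<lambda>i. i \<notin> J)) = set (map ((!) us) [0..<length us])" by auto
  hence "set us = set (?f (\<lambda>i. i \<in> J) @ ?f (\<lambda>i. i \<notin> J))" by (simp only: map_nth)
  moreover have "length us = length (?f (\<lambda>i. i \<in> J) @ ?f (\<lambda>i. i \<notin> J))"
    using sum_length_filter_compl[of "\<lambda>i. i \<in> J" "[0..<length us]"] by simp
  ultimately show ?thesis
    using independent_same_set[OF K _ _ assms(1)] independent_split(2)[OF K] by blast
qed

text \<open>The element \<open>x\<close> is sought in \<open>B\<close> because the first condition
  of the theorem restricts \<open>B \<inter> M\<close>; being outside \<open>K\<close>, it makes the
  stabilizer strictly larger than \<open>K\<close>, as the other two conditions require.\<close>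

lemma stable_subspace_if_not_matched:
  assumes A: "finite_dimension K A" and B: "finite_dimension K B" "dim K A = dim K B"
    and one: "\<one> \<notin> B" and nm: "\<not> matched K A B"
  shows "\<exists>S x. finite_dimension K S \<and> S \<subseteq> A \<and> S \<noteq> {\<zero>} \<and> x \<in> B \<inter> stabilizer S \<and> x \<notin> K"
proof -
  define n where "n = dim K B"
  obtain as where as: "independent K as" "Span K as = A"
    and no: "\<And>bs. ordered_basis K B bs \<Longrightarrow> \<not> bases_matched K A B as bs"
    using nm unfolding matched_def ordered_basis_def by blast
  note Asub = fd_subalgebra[OF A] and Bsub = fd_subalgebra[OF B(1)]
  have n: "length as = n" using dim_eqI[OF dimensionI[OF K as]] B(2) n_def by simp
  have asA: "as ! i \<in> A" if "i < n" for i
    using Span_base_incl[OF K independent_in_carrier[OF as(1)]] as(2) n that by auto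
  have asc: "as ! i \<in> carrier R - {\<zero>}" if "i < n" for i
    using independent_nth_nonzero[OF as(1)] n that by simp
  define V where "V i = ((\<lambda>a. inv (as ! i) \<otimes> a) ` A) \<inter> B" for i
  have V: "subalgebra K (V i) R" "V i \<subseteq> B" if "i < n" for i
    using subalgebra_inter[OF scale_subalgebra[OF inv_nonzero[OF asc[OF that]] Asub] Bsub]
    unfolding V_def by auto
  have "\<not> hall B {..<n} V"
    using hall_basis[OF B(1) n_def[symmetric], of V] no n unfolding bases_matched_def V_def by blast
  then obtain J where J: "J \<subseteq> {..<n}" "\<not> dim K (B \<inter> (\<Inter>i\<in>J. V i)) + card J \<le> n"
    unfolding hall_def using V n_def by auto
  define W where "W = B \<inter> (\<Inter>i\<in>J. V i)"
  have finJ: "finite J" using J(1) finite_subset by blast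
  have W: "finite_dimension K W"
    using fd_subspace[OF B(1) subalgebra_INT[OF finJ Bsub, of V]] V(1) J(1)
    unfolding W_def by blast
  have WB: "W \<subseteq> B" unfolding W_def by blast
  have Wc: "W \<subseteq> carrier R" using subalgebraD(1)[OF fd_subalgebra[OF W]] .
  define ss where "ss = map ((!) as) (filter (\<lambda>i. i \<in> J) [0..<n])"
  define S where "S = Span K ss"
  have ss: "independent K ss" using independent_filter[OF as(1)] J(1) n ss_def by auto
  have "set (filter (\<lambda>i. i \<in> J) [0..<n]) = J" using J(1) by auto
  hence setss: "set ss = (!) as ` J" and lenss: "length ss = card J"
    unfolding ss_def using distinct_card[of "filter (\<lambda>i. i \<in> J) [0..<n]"] by auto
  have S: "finite_dimension K S" "dim K S = card J"
    using dimensionI[OF K ss S_def[symmetric]] finite_dimensionI dim_eqI lenss by auto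
  have SA: "S \<subseteq> A"
    unfolding S_def using asA J(1) setss by (intro subalgebra_Span_incl[OF K Asub]) auto
  have Sc: "S \<subseteq> carrier R" using subalgebraD(1)[OF fd_subalgebra[OF S(1)]] .
  \<comment> \<open>The empty index set satisfies the Hall inequality trivially, so it cannot be the
    violating one.\<close>
  have "card J \<noteq> 0"
    using J(2) finJ n_def by auto
  hence Snz: "S \<noteq> {\<zero>}" using S(2) dim_zero_space by metis
  have SW: "s \<otimes> w \<in> A" if sw: "s \<in> S" "w \<in> W" for s w
  proof -
    have wc: "w \<in> carrier R" using sw(2) Wc by blast
    \<comment> \<open>For fixed \<open>w\<close> the elements multiplied into \<open>A\<close> form
      a subspace, so only the generators of \<open>S\<close> need checking.\<close>
    have "as ! j \<in> {u \<in> carrier R. w \<otimes> u \<in> A}" if j: "j \<in> J" for j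
    proof -
      have jn: "j < n" using j J(1) by blast
      have "w \<in> V j" using sw(2) j unfolding W_def by blast
      then obtain a where a: "a \<in> A" "w = inv (as ! j) \<otimes> a" unfolding V_def by blast
      hence "as ! j \<otimes> w = a"
        using mult_inv_cancel[OF asc[OF jn]] subalgebraD(1)[OF Asub] by auto
      thus ?thesis using a(1) asc[OF jn] wc by (simp add: m_comm)
    qed
    hence "S \<subseteq> {u \<in> carrier R. w \<otimes> u \<in> A}"
      unfolding S_def using setss
      by (intro subalgebra_Span_incl[OF K subalgebra_colon[OF Asub wc]]) auto
    thus ?thesis using sw(1) wc by (auto simp: m_comm)
  qed
  let ?U = "K <+>\<^bsub>R\<^esub> W"
  have U: "finite_dimension K ?U" using fd_sum[OF fd_K W] .
  have "K \<inter> W = {\<zero>}"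
    using K_Int_trivial[OF Bsub one] WB subalgebraD(2)[OF fd_subalgebra[OF W]]
      subringE(2)[OF subfieldE(1)[OF K]] by blast
  hence "dim K ?U = 1 + dim K W"
    using dim_sum[OF fd_K W] dim_K dim_zero_space by simp
  \<comment> \<open>One unit of the surplus comes from the violated inequality, the other from
    adjoining \<open>K\<close>, which meets \<open>W\<close> in zero.\<close>
  hence dims: "dim K A + 2 \<le> dim K S + dim K ?U"
    using J(2) S(2) B(2) n_def W_def by simp
  have oneU: "\<one> \<in> ?U"
  proof -
    have "\<one> \<oplus> \<zero> \<in> ?U"
      using subringE(3)[OF subfieldE(1)[OF K]] subalgebraD(2)[OF fd_subalgebra[OF W]]
      unfolding set_add_def' by blast
    thus ?thesis by simp
  qed
  have SU: "s \<otimes> u \<in> A" if su: "s \<in> S" "u \<in> ?U" for s u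
  proof -
    obtain k w where kw: "k \<in> K" "w \<in> W" "u = k \<oplus> w" using su(2) unfolding set_add_def' by auto
    have c: "k \<in> carrier R" "w \<in> carrier R" "s \<in> carrier R" using kw su(1) K_carrier Wc Sc by auto
    have "s \<otimes> u = k \<otimes> s \<oplus> s \<otimes> w" using kw(3) c by (simp add: r_distr m_comm)
    moreover have "k \<otimes> s \<in> A" using subalgebraD(4)[OF Asub kw(1)] su(1) SA by blast
    ultimately show ?thesis using SW[OF su(1) kw(2)] subalgebraD(3)[OF Asub] by simp
  qed
  obtain T U' where T: "finite_dimension K T" "T \<subseteq> A" "T \<noteq> {\<zero>}"
    and U': "subalgebra K U' R" "U' \<subseteq> ?U" "2 \<le> dim K U'"
    and TU: "\<And>t u. t \<in> T \<Longrightarrow> u \<in> U' \<Longrightarrow> t \<otimes> u \<in> T"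
    using dyson_transform[OF A S(1) Snz U oneU SU dims] by blast
  have Tc: "T \<subseteq> carrier R" using subalgebraD(1)[OF fd_subalgebra[OF T(1)]] .
  have "\<not> U' \<subseteq> K" using dim_mono[OF fd_K U'(1)] U'(3) dim_K by auto
  then obtain u where u: "u \<in> U'" "u \<notin> K" by blast
  obtain k x where kx: "k \<in> K" "x \<in> W" "u = k \<oplus> x" using u(1) U'(2) unfolding set_add_def' by auto
  have kc: "k \<in> carrier R" and xc: "x \<in> carrier R" using kx K_carrier Wc by auto
  note M = subalgebraD[OF stabilizer_subspace[OF fd_subalgebra[OF T(1)]]]
  have uc: "u \<in> carrier R" using kx kc xc by simp
  hence "u \<in> stabilizer T" using TU[OF _ u(1)] Tc by (auto simp: stabilizer_def m_comm)
  moreover have "\<ominus> k \<in> stabilizer T"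
    using M(5) K_subset_stabilizer[OF fd_subalgebra[OF T(1)]] kx(1) by blast
  \<comment> \<open>Removing the \<open>K\<close>-component of \<open>u\<close>, which also
    stabilizes \<open>T\<close>, leaves the component \<open>x\<close> in \<open>W\<close>, hence in
    \<open>B\<close>.\<close>
  ultimately have "\<ominus> k \<oplus> u \<in> stabilizer T" using M(3) by blast
  hence "x \<in> stabilizer T" using kx(3) kc xc by (simp add: a_assoc[symmetric] l_neg)
  moreover have "x \<notin> K" using u(2) kx subringE(7)[OF subfieldE(1)[OF K]] by auto
  ultimately show ?thesis using T kx(2) WB by blast
qed

end

section \<open>Exclusion of the intermediate field\<close>

theorem theorem1p8:
  fixes R :: "('a, 'b) ring_scheme" (structure)
    and K A B :: "'a set" and n :: nat
  assumes "field R" and "subfield K R"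
    and "subalgebra K A R" and "subalgebra K B R"
    and "ring.dimension R n K A" and "ring.dimension R n K B"
    and "\<one> \<notin> B" and "n > 1"
    and "((\<forall>M. subfield M R \<and> K \<subseteq> M \<and> M \<noteq> carrier R \<and> ring.finite_dimension R K M
                \<longrightarrow> B \<inter> M = {\<zero>})
          \<and> (n \<le> 5 \<or> (\<forall>x \<in> carrier R. ring.algebraic R K x \<longrightarrow> ring.separable R K x)))
       \<or> (enat n = ring.min_degree R K
          \<and> \<not> (\<exists>M l. subfield M R \<and> K \<subset> M \<and> M \<noteq> carrier R \<and> l \<in> carrier R - {\<zero>}
                  \<and> A = (\<lambda>m. l \<otimes> m) ` M))
       \<or> ring.sidon R K A"
  shows "ring.matched R K A B"
proof -
  interpret field_extension R K
    using assms(1,2) by (simp add: field_extension_def field_extension_axioms_def)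
  have A: "finite_dimension K A" "dim K A = n" and B: "finite_dimension K B" "dim K B = n"
    using assms(5,6) finite_dimensionI dim_eqI by auto
  show ?thesis
  proof (rule ccontr)
    assume "\<not> matched K A B"
    then obtain S x where S: "finite_dimension K S" "S \<subseteq> A" "S \<noteq> {\<zero>}"
      and x: "x \<in> B" "x \<in> stabilizer S" "x \<notin> K"
      using stable_subspace_if_not_matched[OF A(1) B(1)] A(2) B(2) assms(7) by auto
    have x0: "x \<noteq> \<zero>" using x(3) subringE(2)[OF subfieldE(1)[OF K]] by auto
    note Ssub = fd_subalgebra[OF S(1)]
    obtain s where s: "s \<in> S" "s \<noteq> \<zero>" using S(3) subalgebraD(2)[OF Ssub] by blast
    have sc: "s \<in> carrier R - {\<zero>}" using s subalgebraD(1)[OF Ssub] by blast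
    define M where "M = stabilizer S"
    have M: "subfield M R" "K \<subset> M"
      using stabilizer_subfield[OF S(1)] K_subset_stabilizer[OF Ssub] x unfolding M_def by auto
    note sM = stabilizer_scale[OF S(1) s, folded M_def]
    have M_proper: "M \<noteq> carrier R"
    proof
      assume M_all: "M = carrier R"
      \<comment> \<open>If \<open>M\<close> were all of \<open>L\<close>, then \<open>S\<close>
        would contain \<open>\<one>\<close> and hence all of \<open>L\<close>; by equal dimensions
        \<open>B\<close> would be \<open>L\<close> too and contain \<open>\<one>\<close>.\<close>
      have "\<one> \<in> (\<lambda>m. s \<otimes> m) ` M"
        using M_all subfield_m_inv[OF carrier_is_subfield sc] by force
      hence "\<one> \<in> S" using sM(1) by blast
      hence "c \<in> S" if "c \<in> carrier R" for c
        using that M_all unfolding M_def by (force simp: stabilizer_def)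
      hence "A = carrier R" using S(2) subalgebraD(1)[OF assms(3)] by blast
      hence "B = A"
        using subspace_eqI[OF A(1) assms(4)] subalgebraD(1)[OF assms(4)] A(2) B(2) by simp
      thus False using \<open>A = carrier R\<close> assms(7) by simp
    qed
    have dimM: "dim K M \<le> n"
      using sM(4) dim_mono[OF A(1) Ssub S(2)] A(2) by simp
    from assms(9) consider
        "\<forall>M. subfield M R \<and> K \<subseteq> M \<and> M \<noteq> carrier R \<and> finite_dimension K M \<longrightarrow> B \<inter> M = {\<zero>}"
      | "enat n = min_degree K" "\<nexists>M l. subfield M R \<and> K \<subset> M \<and> M \<noteq> carrier R \<and>
            l \<in> carrier R - {\<zero>} \<and> A = (\<lambda>m. l \<otimes> m) ` M"
      | "sidon K A"
      by argo
    then show False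
    proof cases
      case 1
      hence "B \<inter> M = {\<zero>}" using M M_proper sM(2) by blast
      thus False using x x0 unfolding M_def by blast
    next
      case 2
      note n = 2(1) and no = 2(2)
      \<comment> \<open>Minimality of \<open>n\<close> makes \<open>dim K M\<close> at least
        \<open>n\<close>, so the translate of \<open>M\<close> by \<open>s\<close>, which lies in
        \<open>A\<close>, fills \<open>A\<close>.\<close>
      have "min_degree K \<le> (if finite_dimension K M then enat (dim K M) else \<infinity>)"
        unfolding min_degree_def by (rule INF_lower) (use M in blast)
      hence "n \<le> dim K M" using n[symmetric] sM(2) by simp
      moreover have "subalgebra K ((\<lambda>m. s \<otimes> m) ` M) R"
        using scale_subalgebra[OF sc fd_subalgebra[OF sM(2)]] .
      ultimately have "(\<lambda>m. s \<otimes> m) ` M = A"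
        using subspace_eqI[OF A(1)] sM(1,3) S(2) A(2) by auto
      thus False using no M M_proper sc by blast
    next
      case 3
      then obtain m where m: "m \<le> 1" "dimension m K (A \<inter> (\<lambda>a. x \<otimes> a) ` A)"
        using x(1,3) subalgebraD(1)[OF assms(4)] unfolding sidon_def by blast
      \<comment> \<open>Since \<open>x\<close> maps \<open>S\<close> onto itself, \<open>S\<close>
        lies in both \<open>A\<close> and its translate; but \<open>dim K S\<close> is at least
        \<open>dim K M\<close>, which exceeds 1.\<close>
      have "S \<subseteq> A \<inter> (\<lambda>a. x \<otimes> a) ` A"
        using scale_stable_eq[OF S(1) x(2) x0] S(2) by blast
      hence "dim K S \<le> m"
        using dim_mono[OF finite_dimensionI[OF m(2)] Ssub] dim_eqI[OF m(2)] by simp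
      moreover have "dim K K < dim K M"
        using dim_strict_mono[OF sM(2) fd_subalgebra[OF fd_K] M(2)] .
      ultimately show False using m(1) dim_K sM(4) by simp
    qed
  qed
qed

end
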